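(* Suppose $\alpha=0$. Then $\mathbb{P}^x(T_A<\infty)=1$ for all $A$ if and only if one of the following conditions is violated for some $A\in(0,\infty)$: 1. $\sum_{n=1}^\infty\mathbb{P}^x(\ell(n,Z_n)>A)<\infty$; 2. $\sum_{n=1}^\infty\mathbb{E}^x[\ell(n,Z_n);\,\ell(n,Z_n)\le A]<\infty$; 3. $\sum_{n=1}^\infty\mathbb{V}^x[\ell(n,Z_n);\,\ell(n,Z_n)\le A]<\infty$.
   Context: $(Z_i)_{i\ge1}$ are i.i.d. $[0,\infty)$-valued random variables with finite second moment (their law does not depend on $x$). $\ell(n,z)$ ($n\ge1$, $z\ge0$) is a strictly positive function such that, for each $n$, $z\mapsto\ell(n,z)$ is non-decreasing and continuous. Non-reset dynamics with $\alpha=0$: $N^0$ is a counting process with stochastic intensity $\Lambda^0$; $\Lambda^0$ is constant between jumps of $N^0$, and when $N^0$ jumps to the value $k$, $\Lambda^0$ increases by $\ell(k,Z_k)$. $\mathbb{P}^x$ (with $x=(n,\lambda,z)$, $\lambda>0$) is the law of the system started from $N^0_0=n$, $\Lambda^0_0=\lambda$. A reset occurs when the intensity reaches or exceeds the level $A$; the (first) reset time is $T_A=\inf\{t\ge0:\Lambda^0_t\ge A\}$. Notation: $\mathbb{E}^x[U;B]=\mathbb{E}^x[U\mathbf{1}_B]$, and $\mathbb{V}^x[U;B]$ is the variance of $U\mathbf{1}_B$ under $\mathbb{P}^x$. *)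

theory Defs
  imports "HOL-Probability.Probability"
begin

section \<open>Counting processes and stochastic intensities\<close>

definition left_value :: "(real \<Rightarrow> enat) \<Rightarrow> real \<Rightarrow> enat" where
  "left_value f t = (SUP u\<in>{0..<t}. f u)"

text \<open>
  A counting path may explode, i.e. accumulate infinitely many jumps in finite time; from the
  explosion time on its value is \<open>\<infinity>\<close>. The left limit at the explosion time is itself \<open>\<infinity>\<close>, so the
  explosion time is not a jump time.
\<close>

definition counting_path :: "nat \<Rightarrow> (real \<Rightarrow> enat) \<Rightarrow> bool" where
  "counting_path n0 f \<longleftrightarrow>
     f 0 = enat n0 \<and> mono_on {0..} f \<and> (\<forall>t\<ge>0. continuous (at_right t) f) \<and>
     (\<forall>t>0. f t \<le> left_value f t + 1)"

definition jump_times :: "(real \<Rightarrow> enat) \<Rightarrow> real set" where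
  "jump_times f = {t. 0 < t \<and> left_value f t < f t}"

definition predictable_sigma :: "'a set \<Rightarrow> (real \<Rightarrow> 'a measure) \<Rightarrow> (real \<times> 'a) measure" where
  "predictable_sigma \<Omega> F = sigma ({0..} \<times> \<Omega>)
     ({{0} \<times> B | B. B \<in> sets (F 0)} \<union> {{s<..t} \<times> B | s t B. 0 \<le> s \<and> B \<in> sets (F s)})"

text \<open>
  \<open>L\<close> is the \<open>F\<close>-intensity of \<open>N\<close> when, for every non-negative predictable process \<open>C\<close>,
  the expectations of \<open>\<integral> C dN\<close> (the sum of \<open>C\<close> over the jump times of \<open>N\<close>) and of
  \<open>\<integral> C\<^sub>s L\<^sub>s ds\<close> over \<open>[0, \<infinity>)\<close> coincide.
\<close>

definition has_stochastic_intensity ::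
    "'a measure \<Rightarrow> (real \<Rightarrow> 'a measure) \<Rightarrow> (real \<Rightarrow> 'a \<Rightarrow> enat) \<Rightarrow> (real \<Rightarrow> 'a \<Rightarrow> ennreal) \<Rightarrow> bool"
where
  "has_stochastic_intensity M F N L \<longleftrightarrow>
     (\<forall>t\<ge>0. N t \<in> F t \<rightarrow>\<^sub>M count_space UNIV) \<and>
     (\<forall>t\<ge>0. (\<lambda>(s, \<omega>). L s \<omega>) \<in> borel_measurable (restrict_space borel {0..t} \<Otimes>\<^sub>M F t)) \<and>
     (\<forall>C \<in> borel_measurable (predictable_sigma (space M) F).
        (\<integral>\<^sup>+\<omega>. (\<integral>\<^sup>+s. C (s, \<omega>) \<partial>count_space (jump_times (\<lambda>t. N t \<omega>))) \<partial>M) =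
        (\<integral>\<^sup>+\<omega>. (\<integral>\<^sup>+s\<in>{0..}. C (s, \<omega>) * L s \<omega> \<partial>lborel) \<partial>M))"


section \<open>The non-reset dynamics without decay\<close>

text \<open>
  The path \<open>g\<close> of the intensity driven by the counting path \<open>f\<close> and the marks \<open>z\<close>: it is constant
  between jumps of \<open>f\<close> and increases by \<open>ell k (z k)\<close> when \<open>f\<close> jumps to \<open>k\<close>. After an explosion
  it takes the limit of its (non-decreasing) values before the explosion.
\<close>

definition intensity_path ::
    "(nat \<Rightarrow> real \<Rightarrow> real) \<Rightarrow> (nat \<Rightarrow> real) \<Rightarrow> real \<Rightarrow> (real \<Rightarrow> enat) \<Rightarrow> (real \<Rightarrow> ennreal) \<Rightarrow> bool"
where
  "intensity_path ell z lam f g \<longleftrightarrow>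
     g 0 = ennreal lam \<and>
     (\<forall>s t. 0 \<le> s \<and> s \<le> t \<and> f s = f t \<longrightarrow> g t = g s) \<and>
     (\<forall>s t k. 0 \<le> s \<and> s \<le> t \<and> f s = enat k \<and> f t = enat (Suc k) \<longrightarrow>
        g t = g s + ennreal (ell (Suc k) (z (Suc k)))) \<and>
     (\<forall>t\<ge>0. f t = \<infinity> \<longrightarrow> g t = (SUP s\<in>{s. 0 \<le> s \<and> f s \<noteq> \<infinity>}. g s))"

text \<open>
  The mark \<open>Z k\<close> is revealed when \<open>N\<close> jumps to \<open>k\<close> and is independent of the strict past of that
  jump: the events \<open>B \<in> F t\<close> with \<open>B \<subseteq> {N t < k}\<close> generate the sigma-algebra of events strictly
  before the jump to \<open>k\<close>. Without this requirement the law of the system would not be determined.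
\<close>

definition marks_drawn_at_jumps ::
    "'a measure \<Rightarrow> (real \<Rightarrow> 'a measure) \<Rightarrow> (nat \<Rightarrow> 'a \<Rightarrow> real) \<Rightarrow> nat \<Rightarrow> (real \<Rightarrow> 'a \<Rightarrow> enat) \<Rightarrow> bool"
where
  "marks_drawn_at_jumps M F Z n0 N \<longleftrightarrow>
     (\<forall>t\<ge>0. \<forall>k>n0. \<forall>S\<in>sets borel.
        {\<omega> \<in> space M. enat k \<le> N t \<omega> \<and> Z k \<omega> \<in> S} \<in> sets (F t)) \<and>
     (\<forall>t\<ge>0. \<forall>k>n0. \<forall>B\<in>sets (F t). \<forall>S\<in>sets borel. (\<forall>\<omega>\<in>B. N t \<omega> < enat k) \<longrightarrow>
        measure M {\<omega> \<in> B. Z k \<omega> \<in> S} = measure M B * measure M {\<omega> \<in> space M. Z k \<omega> \<in> S})"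

text \<open>
  A realisation on \<open>(M, F)\<close> of the system under \<open>\<bbbP>\<^sup>x\<close>, \<open>x = (n0, lam, z)\<close>. Neither the dynamics
  nor the law of the marks involves \<open>z\<close>, so it is not a parameter. Truncating \<open>Lam\<close> to \<open>0\<close> after
  the explosion expresses that \<open>Lam\<close> is the intensity of \<open>N\<close> up to the explosion time: there are
  no jumps afterwards.
\<close>

definition nonreset_system ::
    "'a measure \<Rightarrow> (real \<Rightarrow> 'a measure) \<Rightarrow> (nat \<Rightarrow> real \<Rightarrow> real) \<Rightarrow> (nat \<Rightarrow> 'a \<Rightarrow> real) \<Rightarrow> nat \<Rightarrow> real
      \<Rightarrow> (real \<Rightarrow> 'a \<Rightarrow> enat) \<Rightarrow> (real \<Rightarrow> 'a \<Rightarrow> ennreal) \<Rightarrow> bool"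
where
  "nonreset_system M F ell Z n0 lam N Lam \<longleftrightarrow>
     filtration (space M) F \<and> (\<forall>t. subalgebra M (F t)) \<and>
     (\<forall>\<omega>\<in>space M. counting_path n0 (\<lambda>t. N t \<omega>)) \<and>
     (\<forall>\<omega>\<in>space M. intensity_path ell (\<lambda>k. Z k \<omega>) lam (\<lambda>t. N t \<omega>) (\<lambda>t. Lam t \<omega>)) \<and>
     marks_drawn_at_jumps M F Z n0 N \<and>
     has_stochastic_intensity M F N (\<lambda>t \<omega>. if N t \<omega> = \<infinity> then 0 else Lam t \<omega>)"

definition reset_time :: "(real \<Rightarrow> 'a \<Rightarrow> ennreal) \<Rightarrow> real \<Rightarrow> 'a \<Rightarrow> ennreal" where
  "reset_time Lam A \<omega> = (INF t\<in>{t. 0 \<le> t \<and> ennreal A \<le> Lam t \<omega>}. ennreal t)"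

definition truncate_above :: "real \<Rightarrow> ('a \<Rightarrow> real) \<Rightarrow> 'a \<Rightarrow> real" where
  "truncate_above A U \<omega> = U \<omega> * indicator {\<omega>. U \<omega> \<le> A} \<omega>"

end

theory Submission
  imports Defs
begin

text \<open>
  Write \<open>X\<^sub>i = ell (i + 1) Z\<^sub>i\<^sub>+\<^sub>1\<close>. After the jump to \<open>m\<close> the intensity is \<open>lam + (\<Sum>i=n0..<m. X\<^sub>i)\<close>. As
  it stays above \<open>lam > 0\<close>, the counting process almost surely exceeds every level (exploding
  or not), so all levels \<open>A\<close> are reached almost surely iff \<open>\<Sum>X\<^sub>i = \<infinity>\<close> almost surely. The three
  series conditions together amount to \<open>\<Sum>\<bbbE>[min 1 X\<^sub>i] < \<infinity>\<close>, which clearly forces \<open>\<Sum>X\<^sub>i < \<infinity>\<close>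
  almost surely; if it fails, independence and \<open>exp (- x) \<le> 1 - min 1 x / 2\<close> give
  \<open>\<bbbE>[exp (- \<Sum>X\<^sub>i)] = 0\<close>, hence \<open>\<Sum>X\<^sub>i = \<infinity>\<close> almost surely.
\<close>

section \<open>Series of independent non-negative random variables\<close>

text \<open>Pass through \<open>1 / (1 + x)\<close>. For \<open>x \<le> 1\<close> the remaining
  inequality amounts to \<open>x * x \<le> x\<close>; for larger \<open>x\<close> the right-hand
  side is the constant \<open>1 / 2\<close>. This turns means of \<open>exp (- X i)\<close> into the
  truncated means \<open>min 1 (X i)\<close>.\<close>

lemma exp_minus_le_min:
  fixes x :: real
  assumes "0 \<le> x"
  shows "exp (- x) \<le> 1 - min 1 x / 2"
proof -
  have "exp (- x) \<le> inverse (1 + x)"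
    unfolding exp_minus using exp_ge_add_one_self[of x] assms by (intro le_imp_inverse_le) auto
  also have "\<dots> \<le> 1 - min 1 x / 2"
  proof (cases "x \<le> 1")
    case True
    have "x * x \<le> x * 1" using True assms by (intro mult_left_mono) auto
    then show ?thesis using True assms by (auto simp: field_simps)
  qed (use assms in \<open>auto simp: field_simps\<close>)
  finally show ?thesis .
qed

context prob_space
begin

section \<open>Transport of independence along injections and pointwise equality\<close>

lemma indep_sets_reindex:
  assumes inj: "inj_on f I" and ind: "indep_sets F (f ` I)"
  shows "indep_sets (\<lambda>i. F (f i)) I"
  unfolding indep_sets_def
proof (intro conjI ballI allI impI)
  fix i assume "i \<in> I"
  then show "F (f i) \<subseteq> events" using ind by (auto simp: indep_sets_def)
next
  fix J A assume J: "J \<subseteq> I" "J \<noteq> {}" "finite J" and A: "A \<in> Pi J (\<lambda>j. F (f j))"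
  have inv: "inv_into I f (f j) = j" if "j \<in> J" for j
    using inj J that by (auto intro: inv_into_f_f)
  have "prob (\<Inter>j\<in>f ` J. A (inv_into I f j)) = (\<Prod>j\<in>f ` J. prob (A (inv_into I f j)))"
    using J A inv by (intro indep_setsD[OF ind]) auto
  moreover have "(\<Inter>j\<in>f ` J. A (inv_into I f j)) = (\<Inter>j\<in>J. A j)"
    using inv by auto
  moreover have "(\<Prod>j\<in>f ` J. prob (A (inv_into I f j))) = (\<Prod>j\<in>J. prob (A j))"
    using inv inj_on_subset[OF inj J(1)] by (subst prod.reindex) (auto intro!: prod.cong)
  ultimately show "prob (\<Inter>j\<in>J. A j) = (\<Prod>j\<in>J. prob (A j))" by simp
qed

lemma indep_vars_reindex:
  assumes "inj_on f I" "indep_vars M' X (f ` I)"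
  shows "indep_vars (\<lambda>i. M' (f i)) (\<lambda>i. X (f i)) I"
  using assms(2) indep_sets_reindex[OF assms(1)] unfolding indep_vars_def by auto

text \<open>Measurability and the generated sigma-algebras only see values on
  \<open>space M\<close>. This allows a variable to be replaced by one whose formula is measurable
  on the whole real line.\<close>

lemma indep_vars_cong_space:
  assumes eq: "\<And>i \<omega>. i \<in> I \<Longrightarrow> \<omega> \<in> space M \<Longrightarrow> X i \<omega> = Y i \<omega>"
    and ind: "indep_vars M' X I"
  shows "indep_vars M' Y I"
  unfolding indep_vars_def
proof (intro conjI ballI)
  fix i assume i: "i \<in> I"
  have "X i \<in> M \<rightarrow>\<^sub>M M' i" using ind i by (auto simp: indep_vars_def)
  then show "Y i \<in> M \<rightarrow>\<^sub>M M' i" using measurable_cong[of M "X i" "Y i"] eq[OF i] by blast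
next
  have "X i -` A \<inter> space M = Y i -` A \<inter> space M" if "i \<in> I" for i A
    using eq[OF that] by auto
  then have "indep_sets (\<lambda>i. sigma_sets (space M) {Y i -` A \<inter> space M |A. A \<in> sets (M' i)}) I
      \<longleftrightarrow> indep_sets (\<lambda>i. sigma_sets (space M) {X i -` A \<inter> space M |A. A \<in> sets (M' i)}) I"
    by (intro indep_sets_cong) auto
  then show "indep_sets (\<lambda>i. sigma_sets (space M) {Y i -` A \<inter> space M |A. A \<in> sets (M' i)}) I"
    using ind by (simp add: indep_vars_def)
qed

section \<open>Truncated expectations and convergence of the series\<close>

lemma integrable_min_1:
  fixes X :: "'a \<Rightarrow> real"
  assumes [measurable]: "X \<in> borel_measurable M" and nonneg: "\<And>\<omega>. \<omega> \<in> space M \<Longrightarrow> 0 \<le> X \<omega>"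
  shows "integrable M (\<lambda>\<omega>. min 1 (X \<omega>))"
  using nonneg by (intro integrable_const_bound[where B=1]) auto

text \<open>By monotone convergence the sum of the \<open>min 1 (X i)\<close> has finite mean, so it
  is finite almost surely. Its terms then tend to 0, hence are eventually below 1, where
  \<open>min 1 (X i)\<close> and \<open>X i\<close> agree.\<close>

lemma AE_summable_of_summable_min_1:
  fixes X :: "nat \<Rightarrow> 'a \<Rightarrow> real"
  assumes [measurable]: "\<And>i. X i \<in> borel_measurable M"
    and nonneg: "\<And>i \<omega>. \<omega> \<in> space M \<Longrightarrow> 0 \<le> X i \<omega>"
    and sum: "summable (\<lambda>i. expectation (\<lambda>\<omega>. min 1 (X i \<omega>)))"
  shows "AE \<omega> in M. summable (\<lambda>i. X i \<omega>)"
proof -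
  have "(\<integral>\<^sup>+\<omega>. (\<Sum>i. ennreal (min 1 (X i \<omega>))) \<partial>M) = (\<Sum>i. \<integral>\<^sup>+\<omega>. ennreal (min 1 (X i \<omega>)) \<partial>M)"
    by (intro nn_integral_suminf) auto
  also have "\<dots> = (\<Sum>i. ennreal (expectation (\<lambda>\<omega>. min 1 (X i \<omega>))))"
    using nonneg integrable_min_1 by (intro suminf_cong nn_integral_eq_integral) auto
  also have "\<dots> \<noteq> \<infinity>"
    using sum nonneg by (subst suminf_ennreal2) (auto intro!: Bochner_Integration.integral_nonneg)
  finally have "AE \<omega> in M. (\<Sum>i. ennreal (min 1 (X i \<omega>))) \<noteq> \<infinity>"
    by (intro nn_integral_PInf_AE) auto
  then show ?thesis
  proof (rule AE_mp, intro AE_I2 impI)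
    fix \<omega> assume \<omega>: "\<omega> \<in> space M" and fin: "(\<Sum>i. ennreal (min 1 (X i \<omega>))) \<noteq> \<infinity>"
    have sm: "summable (\<lambda>i. min 1 (X i \<omega>))"
      using fin nonneg[OF \<omega>] by (intro summable_suminf_not_top) auto
    then have "\<forall>\<^sub>F i in sequentially. min 1 (X i \<omega>) < 1"
      by (intro order_tendstoD(2)[OF summable_LIMSEQ_zero]) auto
    then have "\<forall>\<^sub>F i in sequentially. min 1 (X i \<omega>) = X i \<omega>"
      by eventually_elim auto
    then show "summable (\<lambda>i. X i \<omega>)"
      using sm by (subst (asm) summable_cong) auto
  qed
qed

text \<open>Independence factorises the mean of \<open>exp (- (\<Sum>i<n. X i \<omega>))\<close>,
  and each factor is at most \<open>exp (- (a i / 2))\<close>. Divergence of the truncated means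
  drives the product to 0, which leaves no mass for convergent series.\<close>

lemma AE_not_summable_of_not_summable_min_1:
  fixes X :: "nat \<Rightarrow> 'a \<Rightarrow> real"
  assumes ind: "indep_vars (\<lambda>_. borel) X UNIV"
    and nonneg: "\<And>i \<omega>. \<omega> \<in> space M \<Longrightarrow> 0 \<le> X i \<omega>"
    and sum: "\<not> summable (\<lambda>i. expectation (\<lambda>\<omega>. min 1 (X i \<omega>)))"
  shows "AE \<omega> in M. \<not> summable (\<lambda>i. X i \<omega>)"
proof -
  have [measurable]: "X i \<in> borel_measurable M" for i
    using ind by (auto simp: indep_vars_def)
  define a where "a i = expectation (\<lambda>\<omega>. min 1 (X i \<omega>))" for i
  have a0: "0 \<le> a i" for i
    unfolding a_def using nonneg by (intro Bochner_Integration.integral_nonneg) auto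
  have int: "integrable M (\<lambda>\<omega>. exp (- X i \<omega>))" for i
    using nonneg by (intro integrable_const_bound[where B=1]) auto
  have factor: "expectation (\<lambda>\<omega>. exp (- X i \<omega>)) \<le> exp (- (a i / 2))" for i
  proof -
    have "expectation (\<lambda>\<omega>. exp (- X i \<omega>)) \<le> expectation (\<lambda>\<omega>. 1 - min 1 (X i \<omega>) / 2)"
      using int integrable_min_1 nonneg exp_minus_le_min by (intro integral_mono) auto
    also have "\<dots> = 1 - a i / 2"
      unfolding a_def using integrable_min_1[of "X i"] nonneg
      by (subst Bochner_Integration.integral_diff) (auto simp: prob_space)
    also have "\<dots> \<le> exp (- (a i / 2))"
      using exp_ge_add_one_self[of "- (a i / 2)"] by simp
    finally show ?thesis .
  qed
  \<comment> \<open>\<open>W\<close> plays the role of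
    \<open>exp (- (\<Sum>i. X i \<omega>))\<close>; as an infimum over partial sums it makes sense,
    with value 0, for divergent series too.\<close>
  define W where "W \<omega> = (INF n. ennreal (exp (- (\<Sum>i<n. X i \<omega>))))" for \<omega>
  have [measurable]: "W \<in> borel_measurable M"
    unfolding W_def by measurable
  have bound: "(\<integral>\<^sup>+\<omega>. W \<omega> \<partial>M) \<le> ennreal (exp (- (\<Sum>i<n. a i / 2)))" for n
  proof -
    have ind': "indep_vars (\<lambda>_. borel) (\<lambda>i \<omega>. exp (- X i \<omega>)) {..<n}"
      by (rule indep_vars_compose2[OF indep_vars_subset[OF ind]]) auto
    have "(\<integral>\<^sup>+\<omega>. W \<omega> \<partial>M) \<le> (\<integral>\<^sup>+\<omega>. ennreal (exp (- (\<Sum>i<n. X i \<omega>))) \<partial>M)"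
      unfolding W_def by (intro nn_integral_mono INF_lower) auto
    also have "\<dots> = (\<integral>\<^sup>+\<omega>. ennreal (\<Prod>i<n. exp (- X i \<omega>)) \<partial>M)"
      by (simp add: exp_sum sum_negf[symmetric])
    also have "\<dots> = ennreal (expectation (\<lambda>\<omega>. \<Prod>i<n. exp (- X i \<omega>)))"
      using indep_vars_integrable[OF _ ind' int] 
      by (intro nn_integral_eq_integral) (auto intro!: prod_nonneg)
    also have "expectation (\<lambda>\<omega>. \<Prod>i<n. exp (- X i \<omega>)) = (\<Prod>i<n. expectation (\<lambda>\<omega>. exp (- X i \<omega>)))"
      by (intro indep_vars_lebesgue_integral ind' int) auto
    also have "ennreal \<dots> \<le> ennreal (\<Prod>i<n. exp (- (a i / 2)))"
      using factor by (intro ennreal_leI prod_mono) auto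
    also have "(\<Prod>i<n. exp (- (a i / 2))) = exp (- (\<Sum>i<n. a i / 2))"
      by (simp add: exp_sum sum_negf[symmetric])
    finally show ?thesis .
  qed
  have div: "\<not> summable (\<lambda>i. a i / 2)"
    using sum summable_mult[of "\<lambda>i. a i / 2" 2] unfolding a_def by auto
  \<comment> \<open>Monotone partial sums of a divergent non-negative series are unbounded and so
    tend to infinity.\<close>
  have "filterlim (\<lambda>n. \<Sum>i<n. a i / 2) at_top sequentially"
    unfolding filterlim_at_top
  proof (intro allI)
    fix K
    have "\<exists>n. K \<le> (\<Sum>i<n. a i / 2)"
    proof (rule ccontr)
      assume "\<nexists>n. K \<le> (\<Sum>i<n. a i / 2)"
      then have "summable (\<lambda>i. a i / 2)"
        using a0 by (intro summableI_nonneg_bounded[where x=K]) (auto simp: not_le less_imp_le)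
      with div show False by contradiction
    qed
    then obtain n where "K \<le> (\<Sum>i<n. a i / 2)" ..
    moreover have "(\<Sum>i<n. a i / 2) \<le> (\<Sum>i<m. a i / 2)" if "n \<le> m" for m
      using a0 that by (intro sum_mono2) auto
    ultimately show "\<forall>\<^sub>F n in sequentially. K \<le> (\<Sum>i<n. a i / 2)"
      unfolding eventually_sequentially by force
  qed
  then have "(\<lambda>n. exp (- (\<Sum>i<n. a i / 2))) \<longlonglongrightarrow> 0"
    by (intro filterlim_compose[OF exp_at_bot] filterlim_compose[OF filterlim_uminus_at_bot_at_top])
  then have "(\<lambda>n. ennreal (exp (- (\<Sum>i<n. a i / 2)))) \<longlonglongrightarrow> 0"
    using tendsto_ennrealI by fastforce
  then have "(\<integral>\<^sup>+\<omega>. W \<omega> \<partial>M) \<le> 0"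
    using bound by (intro LIMSEQ_le_const) auto
  then have "AE \<omega> in M. W \<omega> = 0"
    by (simp add: nn_integral_0_iff_AE)
  then show ?thesis
  proof (rule AE_mp, intro AE_I2 impI notI)
    fix \<omega> assume \<omega>: "\<omega> \<in> space M" "W \<omega> = 0" "summable (\<lambda>i. X i \<omega>)"
    \<comment> \<open>A convergent series would bound \<open>W \<omega>\<close> below by a positive
      number.\<close>
    have "ennreal (exp (- (\<Sum>i. X i \<omega>))) \<le> W \<omega>"
      unfolding W_def using nonneg \<omega> by (intro INF_greatest ennreal_leI) (auto intro!: sum_le_suminf)
    then show False using \<omega> by (simp add: ennreal_le_iff2) 
  qed
qed

text \<open>Every comparison is pointwise and then integrated. Forwards, at level 1,
  \<open>min 1 X\<close> is at most the indicator of \<open>X > 1\<close> plus \<open>X\<close>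
  truncated at 1. Backwards, indicator and truncation are each bounded by a constant multiple of
  \<open>min 1 X\<close>, and the variance by a multiple of the truncated mean.\<close>

lemma three_series_iff_summable_min_1:
  fixes X :: "nat \<Rightarrow> 'a \<Rightarrow> real"
  assumes [measurable]: "\<And>i. X i \<in> borel_measurable M"
    and nonneg: "\<And>i \<omega>. \<omega> \<in> space M \<Longrightarrow> 0 \<le> X i \<omega>"
  shows "(\<forall>A>0. summable (\<lambda>i. prob {\<omega> \<in> space M. X i \<omega> > A}) \<and>
      summable (\<lambda>i. expectation (truncate_above A (X i))) \<and>
      summable (\<lambda>i. variance (truncate_above A (X i)))) \<longleftrightarrow>
    summable (\<lambda>i. expectation (\<lambda>\<omega>. min 1 (X i \<omega>)))" (is "?L \<longleftrightarrow> summable ?a")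
proof -
  have [measurable]: "truncate_above A (X i) \<in> borel_measurable M" for A i
    unfolding truncate_above_def[abs_def] indicator_def by measurable
  \<comment> \<open>The sign of \<open>A\<close> is left open here; for negative \<open>A\<close>
    the truncation vanishes, which explains \<open>max 0 A\<close>.\<close>
  have tr: "0 \<le> truncate_above A (X i) \<omega>" "truncate_above A (X i) \<omega> \<le> max 0 A"
    if "\<omega> \<in> space M" for A i \<omega>
    using nonneg[OF that, of i] by (auto simp: truncate_above_def indicator_def)
  have int_tr: "integrable M (truncate_above A (X i))" for A i
    using tr by (intro integrable_const_bound[where B="max 0 A"]) auto
  have int_tr2: "integrable M (\<lambda>\<omega>. (truncate_above A (X i) \<omega>)\<^sup>2)" for A i
    using tr by (intro integrable_const_bound[where B="(max 0 A)\<^sup>2"]) (auto intro!: power_mono)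
  have int_ind: "integrable M (indicator {\<omega> \<in> space M. X i \<omega> > A} :: 'a \<Rightarrow> real)" for A i
    by (intro integrable_real_indicator) (auto simp: emeasure_eq_measure)
  have int_min: "integrable M (\<lambda>\<omega>. min 1 (X i \<omega>))" for i
    using nonneg by (intro integrable_min_1) auto
  have prob_eq: "prob {\<omega> \<in> space M. X i \<omega> > A} =
      expectation (indicator {\<omega> \<in> space M. X i \<omega> > A})" for A i
    by simp
  show ?thesis
  proof
    assume ?L
    then have "summable (\<lambda>i. prob {\<omega> \<in> space M. X i \<omega> > 1} + expectation (truncate_above 1 (X i)))"
      by (intro summable_add) auto
    then show "summable ?a"
    proof (rule summable_comparison_test_ev[rotated], intro always_eventually allI)
      fix i
      have "?a i \<le> expectation (\<lambda>\<omega>. indicator {\<omega> \<in> space M. X i \<omega> > 1} \<omega> + truncate_above 1 (X i) \<omega>)"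
      proof (intro integral_mono)
        fix \<omega> assume "\<omega> \<in> space M"
        then show "min 1 (X i \<omega>) \<le> indicator {\<omega> \<in> space M. X i \<omega> > 1} \<omega> + truncate_above 1 (X i) \<omega>"
          using nonneg[of \<omega> i] by (auto simp: truncate_above_def indicator_def)
      qed (use int_ind int_tr int_min in auto)
      also have "\<dots> = prob {\<omega> \<in> space M. X i \<omega> > 1} + expectation (truncate_above 1 (X i))"
        using int_ind int_tr by (subst Bochner_Integration.integral_add) auto
      finally show "norm (?a i) \<le> \<dots>"
        using nonneg by (auto intro!: Bochner_Integration.integral_nonneg)
    qed
  next
    assume a: "summable ?a"
    show ?L
    proof (intro allI impI)
      fix A :: real assume A: "A > 0"
      \<comment> \<open>On \<open>X i \<omega> > A\<close> one has
        \<open>min 1 (X i \<omega>) \<ge> min 1 A\<close>, whence the factor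
        \<open>1 / min 1 A\<close>.\<close>
      have 1: "summable (\<lambda>i. prob {\<omega> \<in> space M. X i \<omega> > A})"
      proof (rule summable_comparison_test_ev[OF _ summable_mult[OF a, of "1 / min 1 A"]],
          intro always_eventually allI)
        fix i
        have "prob {\<omega> \<in> space M. X i \<omega> > A} \<le> expectation (\<lambda>\<omega>. 1 / min 1 A * min 1 (X i \<omega>))"
          unfolding prob_eq using int_ind int_min nonneg A
          by (intro integral_mono) (auto simp: indicator_def field_simps min_def)
        then show "norm (prob {\<omega> \<in> space M. X i \<omega> > A}) \<le> 1 / min 1 A * ?a i"
          using int_min by simp
      qed
      \<comment> \<open>Where \<open>X i \<omega> \<le> A\<close>, either
        \<open>X i \<omega> \<le> 1\<close> and it equals its own minimum with 1, or that minimum is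
        1 and \<open>A\<close> bounds the value; \<open>max 1 A\<close> serves both cases.\<close>
      have 2: "summable (\<lambda>i. expectation (truncate_above A (X i)))"
      proof (rule summable_comparison_test_ev[OF _ summable_mult[OF a, of "max 1 A"]],
          intro always_eventually allI)
        fix i
        have "expectation (truncate_above A (X i)) \<le> expectation (\<lambda>\<omega>. max 1 A * min 1 (X i \<omega>))"
        proof (intro integral_mono)
          fix \<omega> assume "\<omega> \<in> space M"
          then show "truncate_above A (X i) \<omega> \<le> max 1 A * min 1 (X i \<omega>)"
            using A nonneg[of \<omega> i] mult_right_mono[of 1 "max 1 A" "X i \<omega>"]
            by (auto simp: truncate_above_def indicator_def min_def)
        qed (use int_tr int_min in auto)
        then show "norm (expectation (truncate_above A (X i))) \<le> max 1 A * ?a i"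
          using int_min tr by (simp add: Bochner_Integration.integral_nonneg)
      qed
      \<comment> \<open>The variance is at most the second moment, and
        \<open>U\<^sup>2 \<le> A * U\<close> whenever \<open>0 \<le> U \<le> A\<close>.\<close>
      have 3: "summable (\<lambda>i. variance (truncate_above A (X i)))"
      proof (rule summable_comparison_test_ev[OF _ summable_mult[OF 2, of A]],
          intro always_eventually allI)
        fix i
        have "variance (truncate_above A (X i)) \<le> expectation (\<lambda>\<omega>. (truncate_above A (X i) \<omega>)\<^sup>2)"
          by (simp add: variance_eq[OF int_tr int_tr2])
        also have "\<dots> \<le> expectation (\<lambda>\<omega>. A * truncate_above A (X i) \<omega>)"
        proof (intro integral_mono)
          fix \<omega> assume "\<omega> \<in> space M"
          then show "(truncate_above A (X i) \<omega>)\<^sup>2 \<le> A * truncate_above A (X i) \<omega>"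
            using A tr[of \<omega> A i] unfolding power2_eq_square by (intro mult_right_mono) auto
        qed (use int_tr int_tr2 in auto)
        finally show "norm (variance (truncate_above A (X i))) \<le> A * expectation (truncate_above A (X i))"
          by (simp add: variance_positive)
      qed
      from 1 2 3 show "summable (\<lambda>i. prob {\<omega> \<in> space M. X i \<omega> > A}) \<and>
          summable (\<lambda>i. expectation (truncate_above A (X i))) \<and>
          summable (\<lambda>i. variance (truncate_above A (X i)))" by blast
    qed
  qed
qed

end

section \<open>Paths of the non-reset dynamics\<close>

lemma counting_path_mono: "counting_path n0 f \<Longrightarrow> 0 \<le> s \<Longrightarrow> s \<le> t \<Longrightarrow> f s \<le> f t"
  by (auto simp: counting_path_def mono_on_def)

lemma counting_path_ge_start: "counting_path n0 f \<Longrightarrow> 0 \<le> t \<Longrightarrow> enat n0 \<le> f t"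
  using counting_path_mono[of n0 f 0 t] by (auto simp: counting_path_def)

text \<open>No level is skipped. At the first time \<open>\<tau>\<close> with value at least
  \<open>k\<close>, right-continuity gives \<open>f \<tau> \<ge> k\<close>, while the left limit is
  at most \<open>k - 1\<close> and the jump at most 1.\<close>

lemma counting_path_attains:
  assumes f: "counting_path n0 f" and "0 \<le> s" "n0 \<le> k" "enat k \<le> f s"
  obtains u where "0 \<le> u" "u \<le> s" "f u = enat k"
proof -
  have f0: "f 0 = enat n0" and rc: "\<And>t. 0 \<le> t \<Longrightarrow> continuous (at_right t) f"
    and jump: "\<And>t. 0 < t \<Longrightarrow> f t \<le> left_value f t + 1"
    using f by (auto simp: counting_path_def)
  define U where "U = {u. 0 \<le> u \<and> enat k \<le> f u}"
  define \<tau> where "\<tau> = Inf U"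
  have U: "U \<noteq> {}" "bdd_below U" "s \<in> U"
    using assms by (auto simp: U_def intro!: bdd_belowI[of _ 0])
  have \<tau>0: "0 \<le> \<tau>" and \<tau>s: "\<tau> \<le> s"
    unfolding \<tau>_def using U by (auto intro!: cInf_greatest cInf_lower simp: U_def)
  have low: "f u < enat k" if "0 \<le> u" "u < \<tau>" for u
    using that U cInf_lower[of u U] by (force simp: U_def \<tau>_def)
  have ge: "enat k \<le> f \<tau>"
  proof (rule ccontr)
    assume less: "\<not> enat k \<le> f \<tau>"
    then have "\<forall>\<^sub>F u in at_right \<tau>. f u < enat k"
      using rc[OF \<tau>0] by (intro order_tendstoD(2)[of f "f \<tau>"]) (auto simp: continuous_within)
    then obtain b where b: "b > \<tau>" "\<And>u. \<tau> < u \<Longrightarrow> u < b \<Longrightarrow> f u < enat k"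
      by (auto simp: eventually_at_right_field)
    obtain v where v: "v \<in> U" "v < b"
      using cInf_lessD[OF U(1)] b(1) unfolding \<tau>_def by blast
    moreover have "\<tau> \<le> v" unfolding \<tau>_def using v U by (intro cInf_lower) auto
    ultimately show False using b(2)[of v] less by (cases "v = \<tau>") (auto simp: U_def not_le)
  qed
  have "f \<tau> = enat k"
  proof (cases "\<tau> = 0")
    case True
    then show ?thesis using f0 ge \<open>n0 \<le> k\<close> by auto
  next
    case False
    then have pos: "0 < \<tau>" using \<tau>0 by simp
    \<comment> \<open>Positivity makes the natural-number subtraction \<open>k - 1\<close> a true
      predecessor.\<close>
    have "k > 0" using low[of 0] pos f0 by (simp add: zero_enat_def)
    have "left_value f \<tau> \<le> enat (k - 1)"
      unfolding left_value_def
    proof (intro SUP_least)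
      fix u assume "u \<in> {0..<\<tau>}"
      then have "f u < enat k" using low by auto
      then show "f u \<le> enat (k - 1)" by (cases "f u") auto
    qed
    then have "f \<tau> \<le> enat (k - 1) + 1"
      using jump[OF pos] add_right_mono order_trans by blast
    also have "\<dots> = enat k" using \<open>k > 0\<close> by (simp add: one_enat_def)
    finally show ?thesis using ge by simp
  qed
  then show ?thesis using that \<tau>0 \<tau>s by blast
qed

text \<open>Induction on the level: the path has visited level \<open>m\<close> before reaching
  \<open>Suc m\<close>, so the increment clause of \<open>intensity_path\<close> adds exactly one
  summand.\<close>

lemma intensity_path_at_finite:
  assumes f: "counting_path n0 f" and g: "intensity_path ell z lam f g"
    and "0 \<le> s" "f s = enat m"
  shows "g s = ennreal lam + (\<Sum>i=n0..<m. ennreal (ell (Suc i) (z (Suc i))))"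
proof -
  have f0: "f 0 = enat n0" using f by (auto simp: counting_path_def)
  have "n0 \<le> m" using counting_path_ge_start[OF f, of s] assms by auto
  then show ?thesis
    using assms(3,4)
  proof (induction m arbitrary: s rule: dec_induct)
    case base
    then have "g s = g 0" using g f0 unfolding intensity_path_def by (metis order_refl)
    then show ?case using g by (simp add: intensity_path_def)
  next
    case (step m)
    obtain u where u: "0 \<le> u" "u \<le> s" "f u = enat m"
      using counting_path_attains[OF f, of s m] step by auto
    then have "g s = g u + ennreal (ell (Suc m) (z (Suc m)))"
      using g step.prems unfolding intensity_path_def by blast
    then show ?case using step.IH[OF u(1,3)] step.hyps by (simp add: add.assoc)
  qed
qed

text \<open>Up to time \<open>t\<close> the path visits each level from \<open>n0\<close> to
  \<open>f t\<close>, and the partial sums increase. For finite \<open>f t\<close> the supremum is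
  the last term; after an explosion it is the limit of the earlier values. The intensity thus
  becomes one function of the current count and the marks.\<close>

lemma intensity_path_eq_SUP:
  assumes f: "counting_path n0 f" and g: "intensity_path ell z lam f g" and "0 \<le> t"
  shows "g t = (SUP m\<in>{m. n0 \<le> m \<and> enat m \<le> f t}.
    ennreal lam + (\<Sum>i=n0..<m. ennreal (ell (Suc i) (z (Suc i)))))" (is "_ = (SUP m\<in>_. ?P m)")
proof (cases "f t")
  case (enat k)
  have mono: "?P m \<le> ?P k" if "m \<le> k" for m
    using that by (intro add_left_mono sum_mono2) auto
  have "n0 \<le> k" using counting_path_ge_start[OF f \<open>0 \<le> t\<close>] enat by simp
  then have "(SUP m\<in>{m. n0 \<le> m \<and> enat m \<le> f t}. ?P m) = ?P k"
    using enat mono by (intro antisym SUP_least SUP_upper) auto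
  then show ?thesis using intensity_path_at_finite[OF f g \<open>0 \<le> t\<close> enat] by simp
next
  case infinity
  have "g t = (SUP s\<in>{s. 0 \<le> s \<and> f s \<noteq> \<infinity>}. g s)"
    using g infinity \<open>0 \<le> t\<close> unfolding intensity_path_def by blast
  also have "\<dots> = (SUP m\<in>{m. n0 \<le> m \<and> enat m \<le> f t}. ?P m)"
  proof (intro antisym SUP_least)
    fix s assume "s \<in> {s. 0 \<le> s \<and> f s \<noteq> \<infinity>}"
    then obtain m where m: "0 \<le> s" "f s = enat m" by auto
    then have "n0 \<le> m" using counting_path_ge_start[OF f, of s] by simp
    then show "g s \<le> (SUP m\<in>{m. n0 \<le> m \<and> enat m \<le> f t}. ?P m)"
      unfolding intensity_path_at_finite[OF f g m] using infinity by (intro SUP_upper) auto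
  next
    fix m assume m: "m \<in> {m. n0 \<le> m \<and> enat m \<le> f t}"
    then obtain u where u: "0 \<le> u" "f u = enat m"
      using counting_path_attains[OF f \<open>0 \<le> t\<close>, of m] by auto
    then show "?P m \<le> (SUP s\<in>{s. 0 \<le> s \<and> f s \<noteq> \<infinity>}. g s)"
      unfolding intensity_path_at_finite[OF f g u, symmetric] by (intro SUP_upper) auto
  qed
  finally show ?thesis .
qed

text \<open>Left values strictly increase along jump times, so they map these times injectively into
  \<open>{0..k}\<close>.\<close>

lemma finite_jump_times_below:
  assumes mono: "mono_on {0..} f"
  shows "finite {s \<in> jump_times f. left_value f s \<le> enat k}"
    and "card {s \<in> jump_times f. left_value f s \<le> enat k} \<le> Suc k"
proof -
  let ?J = "{s \<in> jump_times f. left_value f s \<le> enat k}"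
  have less: "left_value f s < left_value f t" if "s \<in> ?J" "t \<in> ?J" "s < t" for s t
  proof -
    have "left_value f s < f s" using that by (auto simp: jump_times_def)
    also have "f s \<le> left_value f t"
      unfolding left_value_def using that by (intro SUP_upper) (auto simp: jump_times_def)
    finally show ?thesis .
  qed
  have inj: "inj_on (left_value f) ?J"
    by (rule linorder_inj_onI) (use less in \<open>force+\<close>)
  have sub: "left_value f ` ?J \<subseteq> enat ` {..k}"
  proof
    fix e assume "e \<in> left_value f ` ?J"
    then have "e \<le> enat k" by auto
    then show "e \<in> enat ` {..k}" by (cases e) auto
  qed
  show "finite ?J"
    by (rule inj_on_finite[OF inj sub]) auto
  have "card ?J \<le> card (enat ` {..k})"
    by (rule card_inj_on_le[OF inj sub]) auto
  also have "\<dots> = Suc k" by (subst card_image) (auto simp: inj_on_def)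
  finally show "card ?J \<le> Suc k" .
qed

section \<open>The counting process exceeds every level\<close>

lemma emeasure_lborel_atLeast: "emeasure lborel {a::real..} = \<infinity>"
proof (rule ccontr)
  assume "emeasure lborel {a..} \<noteq> \<infinity>"
  then obtain n where "emeasure lborel {a..} < of_nat n"
    using ennreal_Ex_less_of_nat[of "emeasure lborel {a..}"] by (auto simp: top.not_eq_extremum)
  moreover have "of_nat n = emeasure lborel {a..a + real n}"
    by (simp add: ennreal_of_nat_eq_real_of_nat)
  moreover have "\<dots> \<le> emeasure lborel {a..}"
    by (intro emeasure_mono) auto
  ultimately show False by simp
qed

text \<open>
  Test the intensity identity against the indicator of \<open>{N\<^sub>s\<^sub>- \<le> k}\<close>: there are at most \<open>k + 1\<close>
  jumps from such states, whereas the integral of the intensity is infinite on the event that \<open>N\<close>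
  never exceeds \<open>k\<close>.
\<close>

lemma AE_counting_unbounded:
  assumes "prob_space M" and sub: "\<And>t. subalgebra M (F t)"
    and N: "\<And>\<omega>. \<omega> \<in> space M \<Longrightarrow> counting_path n0 (\<lambda>t. N t \<omega>)"
    and L: "has_stochastic_intensity M F N L"
    and lam: "lam > 0"
    and L_ge: "\<And>t \<omega>. 0 \<le> t \<Longrightarrow> \<omega> \<in> space M \<Longrightarrow> N t \<omega> \<noteq> \<infinity> \<Longrightarrow> ennreal lam \<le> L t \<omega>"
  shows "AE \<omega> in M. \<exists>n. enat k < N (real n) \<omega>"
proof -
  interpret prob_space M by fact
  have F_sub: "space (F t) = space M" "sets (F t) \<subseteq> sets M" for t
    using sub[of t] by (auto simp: subalgebra_def)
  have N_F: "N t \<in> F t \<rightarrow>\<^sub>M count_space UNIV" if "0 \<le> t" for t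
    using L that by (auto simp: has_stochastic_intensity_def)
  have N_M[measurable]: "N (real n) \<in> M \<rightarrow>\<^sub>M count_space UNIV" for n
    by (rule measurable_from_subalg[OF sub N_F]) simp
  have mono: "N s \<omega> \<le> N t \<omega>" if "\<omega> \<in> space M" "0 \<le> s" "s \<le> t" for s t \<omega>
    using counting_path_mono[OF N[OF that(1)] that(2,3)] .
  \<comment> \<open>Over \<open>{0..}\<close> and \<open>space M\<close>, the complement of
    \<open>D\<close> is the set where the left value of \<open>N\<close> is at most
    \<open>k\<close>. Rational \<open>q\<close> and bounded intervals present \<open>D\<close> as a
    countable union of generators of the predictable sigma-algebra.\<close>
  define D where "D = (\<Union>q\<in>{q\<in>\<rat>. (0::real) \<le> q}. \<Union>n::nat.
      {q<..real n} \<times> {\<omega>\<in>space M. enat k < N q \<omega>})"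
  have pow: "{{0} \<times> B | B. B \<in> sets (F 0)} \<union> {{s<..t} \<times> B | s t B. 0 \<le> s \<and> B \<in> sets (F s)}
      \<subseteq> Pow ({0..} \<times> space M)"
    using F_sub sets.sets_into_space by fastforce
  have "{q<..real n} \<times> {\<omega>\<in>space M. enat k < N q \<omega>} \<in> sets (predictable_sigma (space M) F)"
    if "q \<in> {q\<in>\<rat>. 0 \<le> q}" for q n
  proof -
    from that have "{\<omega>\<in>space M. enat k < N q \<omega>} \<in> sets (F q)"
      using measurable_sets[OF N_F[of q], of "{e. enat k < e}"] F_sub(1)[of q]
      by (auto simp: vimage_def Int_def conj_commute)
    then show ?thesis
      unfolding predictable_sigma_def sets_measure_of[OF pow] using that
      by (intro sigma_sets.Basic) blast
  qed
  moreover have "countable {q\<in>\<rat>. (0::real) \<le> q}"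
    by (rule countable_subset[OF _ countable_rat]) auto
  ultimately have "D \<in> sets (predictable_sigma (space M) F)"
    unfolding D_def by (intro sets.countable_UN'' sets.countable_UN) auto
  then have C: "(indicator (- D) :: _ \<Rightarrow> ennreal) \<in> borel_measurable (predictable_sigma (space M) F)"
    by (subst borel_measurable_indicator_iff) (simp add: Int_commute flip: Diff_eq)
  have D_iff: "(s, \<omega>) \<in> D \<longleftrightarrow> (\<exists>q\<in>\<rat>. 0 \<le> q \<and> q < s \<and> enat k < N q \<omega>)" if "\<omega> \<in> space M" for s \<omega>
    using that real_arch_simple[of s] unfolding D_def by auto
  have left: "left_value (\<lambda>t. N t \<omega>) s \<le> enat k" if "\<omega> \<in> space M" "(s, \<omega>) \<notin> D" for s \<omega>
    unfolding left_value_def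
  proof (intro SUP_least)
    fix u assume u: "u \<in> {0..<s}"
    then obtain q where q: "q \<in> \<rat>" "u < q" "q < s" using Rats_dense_in_real[of u s] by auto
    have "N u \<omega> \<le> N q \<omega>" using that u q by (intro mono) auto
    also have "\<dots> \<le> enat k" using that u q D_iff[OF that(1), of s] by force
    finally show "N u \<omega> \<le> enat k" .
  qed
  \<comment> \<open>\<open>B\<close> is the event that \<open>N\<close> never exceeds
    \<open>k\<close>; by monotonicity integer times suffice, which gives measurability. If
    \<open>\<infinity> * indicator B\<close> has finite mean, \<open>B\<close> is null.\<close>
  define B where "B = {\<omega> \<in> space M. \<forall>n. N (real n) \<omega> \<le> enat k}"
  have [measurable]: "B \<in> sets M" unfolding B_def by measurable
  have "(\<integral>\<^sup>+\<omega>. \<infinity> * indicator B \<omega> \<partial>M)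
      \<le> (\<integral>\<^sup>+\<omega>. (\<integral>\<^sup>+s\<in>{0..}. indicator (- D) (s, \<omega>) * L s \<omega> \<partial>lborel) \<partial>M)"
  proof (intro nn_integral_mono)
    fix \<omega> assume \<omega>: "\<omega> \<in> space M"
    show "\<infinity> * indicator B \<omega> \<le> (\<integral>\<^sup>+s\<in>{0..}. indicator (- D) (s, \<omega>) * L s \<omega> \<partial>lborel)"
    proof (cases "\<omega> \<in> B")
      case True
      have small: "N s \<omega> \<le> enat k" if "0 \<le> s" for s
      proof -
        obtain n where "s \<le> real n" using real_arch_simple by blast
        then have "N s \<omega> \<le> N (real n) \<omega>" using that \<omega> by (intro mono) auto
        then show ?thesis using True order_trans by (auto simp: B_def)
      qed
      have "(\<integral>\<^sup>+s. ennreal lam * indicator {0::real..} s \<partial>lborel) = ennreal lam * \<infinity>"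
        by (subst nn_integral_cmult_indicator) (auto simp: emeasure_lborel_atLeast)
      then have "\<infinity> = (\<integral>\<^sup>+s. ennreal lam * indicator {0::real..} s \<partial>lborel)"
        using lam by (simp add: ennreal_mult_eq_top_iff)
      also have "\<dots> \<le> (\<integral>\<^sup>+s\<in>{0..}. indicator (- D) (s, \<omega>) * L s \<omega> \<partial>lborel)"
      proof (intro nn_integral_mono)
        fix s :: real
        have "(s, \<omega>) \<notin> D" using D_iff[OF \<omega>] small by (meson not_le)
        moreover have "ennreal lam \<le> L s \<omega>" if "0 \<le> s"
          using L_ge[OF that \<omega>] small[OF that] by (cases "N s \<omega>") auto
        ultimately show "ennreal lam * indicator {0..} s
            \<le> indicator (- D) (s, \<omega>) * L s \<omega> * indicator {0..} s"
          by (auto simp: indicator_def)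
      qed
      finally show ?thesis using True by simp
    qed simp
  qed
  also have "\<dots> = (\<integral>\<^sup>+\<omega>. (\<integral>\<^sup>+s. indicator (- D) (s, \<omega>) \<partial>count_space (jump_times (\<lambda>t. N t \<omega>))) \<partial>M)"
    using L C unfolding has_stochastic_intensity_def by force
  also have "\<dots> \<le> (\<integral>\<^sup>+\<omega>. of_nat (Suc k) \<partial>M)"
  proof (intro nn_integral_mono)
    fix \<omega> assume \<omega>: "\<omega> \<in> space M"
    let ?f = "\<lambda>t. N t \<omega>"
    let ?J = "{s \<in> jump_times ?f. left_value ?f s \<le> enat k}"
    have fm: "mono_on {0..} ?f" using N[OF \<omega>] by (simp add: counting_path_def)
    have "(\<integral>\<^sup>+s. indicator (- D) (s, \<omega>) \<partial>count_space (jump_times ?f))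
        \<le> (\<integral>\<^sup>+s. indicator ?J s \<partial>count_space (jump_times ?f))"
      using left[OF \<omega>] by (intro nn_integral_mono) (auto simp: indicator_def)
    also have "\<dots> = of_nat (card ?J)"
      using finite_jump_times_below(1)[OF fm, of k] by (subst nn_integral_indicator) auto
    also have "\<dots> \<le> of_nat (Suc k)"
      using finite_jump_times_below(2)[OF fm, of k] by (intro of_nat_mono)
    finally show "(\<integral>\<^sup>+s. indicator (- D) (s, \<omega>) \<partial>count_space (jump_times ?f)) \<le> of_nat (Suc k)" .
  qed
  also have "\<dots> < \<infinity>" by (simp add: emeasure_space_1 ennreal_mult_less_top of_nat_less_top)
  finally have "AE \<omega> in M. \<infinity> * indicator B \<omega> \<noteq> (\<infinity>::ennreal)"
    by (intro nn_integral_PInf_AE) auto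
  then show ?thesis
    by (rule AE_mp) (auto intro!: AE_I2 simp: B_def indicator_def not_le split: if_splits)
qed

section \<open>The reset time\<close>

theorem theorem3p1:
  fixes M :: "'a measure" and F :: "real \<Rightarrow> 'a measure"
    and Z :: "nat \<Rightarrow> 'a \<Rightarrow> real" and ell :: "nat \<Rightarrow> real \<Rightarrow> real"
    and n0 :: nat and lam :: real
    and N :: "real \<Rightarrow> 'a \<Rightarrow> enat" and Lam :: "real \<Rightarrow> 'a \<Rightarrow> ennreal"
  assumes "prob_space M"
    and "prob_space.indep_vars M (\<lambda>_. borel) Z {1..}"
    and "\<And>k. k \<ge> 1 \<Longrightarrow> distr M borel (Z k) = distr M borel (Z 1)"
    and "\<And>k \<omega>. k \<ge> 1 \<Longrightarrow> \<omega> \<in> space M \<Longrightarrow> Z k \<omega> \<ge> 0"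
    and "\<And>k. k \<ge> 1 \<Longrightarrow> integrable M (\<lambda>\<omega>. (Z k \<omega>)\<^sup>2)"
    and "\<And>n z. n \<ge> 1 \<Longrightarrow> z \<ge> 0 \<Longrightarrow> ell n z > 0"
    and "\<And>n. n \<ge> 1 \<Longrightarrow> mono_on {0..} (ell n)"
    and "\<And>n. n \<ge> 1 \<Longrightarrow> continuous_on {0..} (ell n)"
    and "lam > 0"
    and "nonreset_system M F ell Z n0 lam N Lam"
  shows "(\<forall>A>0. measure M {\<omega> \<in> space M. reset_time Lam A \<omega> < \<infinity>} = 1) \<longleftrightarrow>
    (\<exists>A>0.
      \<not> summable (\<lambda>i. measure M {\<omega> \<in> space M. ell (Suc i) (Z (Suc i) \<omega>) > A}) \<or>
      \<not> summable (\<lambda>i. prob_space.expectation M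
          (truncate_above A (\<lambda>\<omega>. ell (Suc i) (Z (Suc i) \<omega>)))) \<or>
      \<not> summable (\<lambda>i. prob_space.variance M
          (truncate_above A (\<lambda>\<omega>. ell (Suc i) (Z (Suc i) \<omega>)))))"
proof -
  interpret prob_space M by fact
  define X where "X i \<omega> = ell (Suc i) (Z (Suc i) \<omega>)" for i \<omega>
  have X_pos: "0 < X i \<omega>" if "\<omega> \<in> space M" for i \<omega>
    unfolding X_def using assms(4)[of "Suc i" \<omega>] assms(6) that by simp
  have X_nonneg: "0 \<le> X i \<omega>" if "\<omega> \<in> space M" for i \<omega>
    using X_pos[OF that, of i] by simp
  have indep: "indep_vars (\<lambda>_. borel) X UNIV"
  proof -
    \<comment> \<open>\<open>ell (Suc i)\<close> is continuous only on \<open>{0..}\<close>;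
      composing with \<open>max 0\<close> extends it continuously to the real line and changes
      nothing at the non-negative marks.\<close>
    have cont: "(\<lambda>z. ell (Suc i) (max 0 z)) \<in> borel_measurable borel" for i
      by (intro borel_measurable_continuous_onI continuous_on_compose2[OF assms(8)[of "Suc i"]]
          continuous_intros) auto
    have "indep_vars (\<lambda>_. borel) (\<lambda>i. Z (Suc i)) UNIV"
      by (rule indep_vars_reindex[where X=Z]) (auto intro!: indep_vars_subset[OF assms(2)])
    then have "indep_vars (\<lambda>_. borel) (\<lambda>i \<omega>. ell (Suc i) (max 0 (Z (Suc i) \<omega>))) UNIV"
      by (rule indep_vars_compose2) (rule cont)
    then show ?thesis
      by (rule indep_vars_cong_space[rotated])
        (use assms(4) in \<open>auto simp: X_def max_def dest: antisym\<close>)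
  qed
  then have X_meas[measurable]: "X i \<in> borel_measurable M" for i
    by (auto simp: indep_vars_def)

  \<comment> \<open>The intensity as a function of the current count\<close>
  have sys: "\<And>t. subalgebra M (F t)"
      "\<And>\<omega>. \<omega> \<in> space M \<Longrightarrow> counting_path n0 (\<lambda>t. N t \<omega>)"
      "\<And>\<omega>. \<omega> \<in> space M \<Longrightarrow> intensity_path ell (\<lambda>k. Z k \<omega>) lam (\<lambda>t. N t \<omega>) (\<lambda>t. Lam t \<omega>)"
      "has_stochastic_intensity M F N (\<lambda>t \<omega>. if N t \<omega> = \<infinity> then 0 else Lam t \<omega>)"
    using assms(10) by (auto simp: nonreset_system_def)
  \<comment> \<open>\<open>P m\<close> is the intensity while the count equals \<open>m\<close>;
    \<open>G e\<close> below also accepts \<open>e = \<infinity>\<close> and so covers the time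
    after an explosion.\<close>
  define P where "P m \<omega> = ennreal lam + (\<Sum>i=n0..<m. ennreal (X i \<omega>))" for m \<omega>
  have P_real: "P m \<omega> = ennreal (lam + (\<Sum>i=n0..<m. X i \<omega>))" if "\<omega> \<in> space M" for m \<omega>
    unfolding P_def using X_nonneg[OF that] \<open>lam > 0\<close> by (simp add: sum_ennreal sum_nonneg)
  have [measurable]: "P m \<in> borel_measurable M" for m
    unfolding P_def by measurable
  define G where "G e \<omega> = (SUP m\<in>{m. n0 \<le> m \<and> enat m \<le> e}. P m \<omega>)" for e \<omega>
  have Lam_eq: "Lam t \<omega> = G (N t \<omega>) \<omega>" if "\<omega> \<in> space M" "0 \<le> t" for t \<omega>
    using intensity_path_eq_SUP[OF sys(2)[OF that(1)] sys(3)[OF that(1)] that(2)]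
    by (simp add: G_def P_def X_def)
  have G_upper: "P m \<omega> \<le> G e \<omega>" if "n0 \<le> m" "enat m \<le> e" for m e \<omega>
    unfolding G_def using that by (intro SUP_upper) auto
  have Lam_mono: "Lam s \<omega> \<le> Lam t \<omega>" if "\<omega> \<in> space M" "0 \<le> s" "s \<le> t" for s t \<omega>
    using counting_path_mono[OF sys(2)[OF that(1)] that(2,3)] that
    by (auto simp: Lam_eq G_def intro!: SUP_subset_mono)

  \<comment> \<open>Measurability of the reset event\<close>
  have reset_iff: "reset_time Lam A \<omega> < \<infinity> \<longleftrightarrow> (\<exists>t\<ge>0. ennreal A \<le> Lam t \<omega>)" for A \<omega>
    unfolding reset_time_def by (auto simp: INF_less_iff)
  \<comment> \<open>The intensity is non-decreasing in time, so a level reached at some time is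
    still reached at the next integer; the event becomes a countable union.\<close>
  have reset_iff_nat: "reset_time Lam A \<omega> < \<infinity> \<longleftrightarrow> (\<exists>n. ennreal A \<le> G (N (real n) \<omega>) \<omega>)"
    if "\<omega> \<in> space M" for A \<omega>
  proof -
    have "(\<exists>t\<ge>0. ennreal A \<le> Lam t \<omega>) \<longleftrightarrow> (\<exists>n. ennreal A \<le> Lam (real n) \<omega>)"
      using real_arch_simple Lam_mono[OF that] order_trans by (metis of_nat_0_le_iff)
    then show ?thesis using reset_iff Lam_eq[OF that] by simp
  qed
  have [measurable]: "N (real n) \<in> M \<rightarrow>\<^sub>M count_space UNIV" for n
    using sys(4) unfolding has_stochastic_intensity_def
    by (intro measurable_from_subalg[OF sys(1)[of "real n"]]) simp
  \<comment> \<open>\<open>enat\<close> is countable, so measurability of each \<open>G e\<close>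
    carries over to the random index \<open>N (real n)\<close>.\<close>
  have [measurable]: "(\<lambda>\<omega>. G (N (real n) \<omega>) \<omega>) \<in> borel_measurable M" for n
    by (rule measurable_compose_countable[where f=G]) (auto simp: G_def[abs_def])
  have reset_event: "{\<omega> \<in> space M. reset_time Lam A \<omega> < \<infinity>} \<in> events" for A
  proof -
    have "{\<omega> \<in> space M. reset_time Lam A \<omega> < \<infinity>}
        = {\<omega> \<in> space M. \<exists>n. ennreal A \<le> G (N (real n) \<omega>) \<omega>}"
      using reset_iff_nat by blast
    also have "\<dots> \<in> events" by measurable
    finally show ?thesis .
  qed

  \<comment> \<open>Before an explosion the intensity is at least its starting value
    \<open>P n0\<close>, that is \<open>lam\<close>.\<close>
  have unbounded: "AE \<omega> in M. \<forall>k. \<exists>n. enat k < N (real n) \<omega>"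
  proof (subst AE_all_countable, intro allI)
    fix k
    show "AE \<omega> in M. \<exists>n. enat k < N (real n) \<omega>"
    proof (rule AE_counting_unbounded[OF assms(1) sys(1,2,4) \<open>lam > 0\<close>])
      fix t \<omega> assume t: "0 \<le> t" "\<omega> \<in> space M" "N t \<omega> \<noteq> \<infinity>"
      have "ennreal lam = P n0 \<omega>" by (simp add: P_def)
      also have "\<dots> \<le> Lam t \<omega>"
        using t counting_path_ge_start[OF sys(2), of \<omega> t] by (simp add: Lam_eq G_upper)
      finally show "ennreal lam \<le> (if N t \<omega> = \<infinity> then 0 else Lam t \<omega>)" using t by auto
    qed
  qed

  \<comment> \<open>Almost sure reset and divergence of the truncated means\<close>
  let ?a = "\<lambda>i. expectation (\<lambda>\<omega>. min 1 (X i \<omega>))"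
  have "(\<forall>A>0. prob {\<omega> \<in> space M. reset_time Lam A \<omega> < \<infinity>} = 1) \<longleftrightarrow> \<not> summable ?a"
  proof
    assume "\<not> summable ?a"
    then have div: "AE \<omega> in M. \<not> summable (\<lambda>i. X i \<omega>)"
      using indep X_nonneg by (intro AE_not_summable_of_not_summable_min_1)
    show "\<forall>A>0. prob {\<omega> \<in> space M. reset_time Lam A \<omega> < \<infinity>} = 1"
    proof (intro allI impI)
      fix A :: real
      have "AE \<omega> in M. reset_time Lam A \<omega> < \<infinity>"
        using div unbounded AE_space
      proof eventually_elim
        case (elim \<omega>)
        \<comment> \<open>Otherwise \<open>A\<close> bounds all partial sums from \<open>n0\<close>
          on, and the non-negative series would converge.\<close>
        have "\<exists>m\<ge>n0. A \<le> (\<Sum>i=n0..<m. X i \<omega>)"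
        proof (rule ccontr)
          assume *: "\<not> ?thesis"
          have "(\<Sum>i<n. X (i + n0) \<omega>) \<le> A" for n
            using *[unfolded not_ex, rule_format, of "n + n0"] sum.shift_bounds_nat_ivl[of "\<lambda>i. X i \<omega>" 0 n0 n]
            by (simp add: atLeast0LessThan)
          then have "summable (\<lambda>i. X (i + n0) \<omega>)"
            using X_nonneg[OF elim(3)] by (intro summableI_nonneg_bounded)
          then show False using elim(1) summable_iff_shift[of "\<lambda>i. X i \<omega>" n0] by blast
        qed
        then obtain m where m: "n0 \<le> m" "A \<le> (\<Sum>i=n0..<m. X i \<omega>)" by blast
        obtain n where n: "enat m < N (real n) \<omega>" using elim by blast
        have "ennreal A \<le> P m \<omega>"
          unfolding P_real[OF elim(3)] using m \<open>lam > 0\<close> by (intro ennreal_leI) auto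
        also have "\<dots> \<le> G (N (real n) \<omega>) \<omega>" using m n by (intro G_upper) auto
        finally show ?case using reset_iff_nat[OF elim(3)] by blast
      qed
      then show "prob {\<omega> \<in> space M. reset_time Lam A \<omega> < \<infinity>} = 1"
        using prob_Collect_eq_1[OF reset_event] by blast
    qed
  next
    assume reset: "\<forall>A>0. prob {\<omega> \<in> space M. reset_time Lam A \<omega> < \<infinity>} = 1"
    show "\<not> summable ?a"
    proof
      assume "summable ?a"
      then have "AE \<omega> in M. summable (\<lambda>i. X i \<omega>)"
        using X_nonneg by (intro AE_summable_of_summable_min_1) auto
      \<comment> \<open>Countably many levels keep the exceptional set null; \<open>Suc n\<close>
        makes each level positive, as \<open>reset\<close> demands.\<close>
      moreover have "AE \<omega> in M. \<forall>n. reset_time Lam (real (Suc n)) \<omega> < \<infinity>"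
      proof (subst AE_all_countable, intro allI)
        fix n
        have "prob {\<omega> \<in> space M. reset_time Lam (real (Suc n)) \<omega> < \<infinity>} = 1"
          using reset by simp
        from AE_prob_1[OF this] show "AE \<omega> in M. reset_time Lam (real (Suc n)) \<omega> < \<infinity>" by simp
      qed
      ultimately have "AE \<omega> in M. False"
        using AE_space
      proof eventually_elim
        case (elim \<omega>)
        \<comment> \<open>When the series converges, \<open>?S\<close> bounds the intensity at all
          times, including after an explosion, so a level above \<open>?S\<close> cannot be
          reached.\<close>
        let ?S = "lam + (\<Sum>i. X i \<omega>)"
        have S: "0 \<le> (\<Sum>i. X i \<omega>)" using elim X_nonneg by (intro suminf_nonneg) auto
        obtain n where n: "?S < real n" using reals_Archimedean2 by blast
        obtain k where k: "ennreal (real (Suc n)) \<le> G (N (real k) \<omega>) \<omega>"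
          using elim reset_iff_nat by blast
        also have "\<dots> \<le> ennreal ?S"
          unfolding G_def
        proof (intro SUP_least)
          fix m
          show "P m \<omega> \<le> ennreal ?S"
            unfolding P_real[OF elim(3)] using elim X_nonneg
            by (intro ennreal_leI add_left_mono sum_le_suminf) auto
        qed
        finally have "real (Suc n) \<le> ?S"
          using S \<open>lam > 0\<close> by (subst (asm) ennreal_le_iff) auto
        then show False using n by simp
      qed
      then show False by simp
    qed
  qed
  also have "summable ?a \<longleftrightarrow> (\<forall>A>0.
      summable (\<lambda>i. prob {\<omega> \<in> space M. X i \<omega> > A}) \<and>
      summable (\<lambda>i. expectation (truncate_above A (X i))) \<and>
      summable (\<lambda>i. variance (truncate_above A (X i))))"
    by (rule three_series_iff_summable_min_1[symmetric]) (use X_meas X_nonneg in auto)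
  finally show ?thesis
    unfolding X_def[abs_def] not_all not_imp de_Morgan_conj .
qed

end
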